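(* Let $G\subseteq K_{m,n}$ be a bipartite graph with no isolated vertices, with associated subsets $I_1,\dots,I_m\subseteq[n]$. For nonnegative integers $y_1,\dots,y_m$, the number of lattice points in the trimmed generalized permutohedron $P_G^-(y_1,\dots,y_m)$ equals $$\#\bigl(P_G^-(y_1,\dots,y_m)\cap\mathbb{Z}^n\bigr)=\sum_{(a_1,\dots,a_m)}\frac{(y_1)_{a_1}}{a_1!}\cdots\frac{(y_m)_{a_m}}{a_m!},$$ where the sum is over all $G$-draconian sequences $(a_1,\dots,a_m)$. In particular, if $I_1=[n]$, then the number of lattice points in $P_G(y_1,\dots,y_m)$ equals $$\#\bigl(P_G(y_1,\dots,y_m)\cap\mathbb{Z}^n\bigr)=\sum_{(a_1,\dots,a_m)}\frac{(y_1+1)_{a_1}}{a_1!}\,\frac{(y_2)_{a_2}}{a_2!}\cdots\frac{(y_m)_{a_m}}{a_m!},$$ where the sum is over all $G$-draconian sequences $(a_1,\dots,a_m)$. Also, the number of lattice points in $P_G^-(1,\dots,1)$ equals the number of $G$-draconian sequences.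
   Context: $[n]=\{1,\dots,n\}$; $m,n\ge1$. The vertices of $G\subseteq K_{m,n}$ are labeled $1,\dots,m$ (left vertices) and $\bar1,\dots,\bar n$ (right vertices). $G$ is associated with the nonempty subsets $I_1,\dots,I_m\subseteq[n]$ given by $j\in I_i$ if and only if $(i,\bar j)$ is an edge of $G$. For nonempty $I\subseteq[n]$, $\Delta_I=\mathrm{ConvexHull}(e_i\mid i\in I)\subset\mathbb{R}^n$, with $e_i$ the coordinate vectors. The generalized permutohedron is the Minkowski sum $P_G(y_1,\dots,y_m)=y_1\Delta_{I_1}+\cdots+y_m\Delta_{I_m}$. The trimmed generalized permutohedron is the Minkowski difference $$P_G^-(y_1,\dots,y_m)=P_G(y_1,\dots,y_m)-\Delta_{[n]}=\{x\in\mathbb{R}^n\mid x+\Delta_{[n]}\subseteq P_G(y_1,\dots,y_m)\}$$ (which may be empty). A sequence of nonnegative integers $(a_1,\dots,a_m)$ is $G$-draconian if $\sum_i a_i=n-1$ and, for any nonempty subset $\{i_1<\cdots<i_k\}\subseteq[m]$, we have $|I_{i_1}\cup\cdots\cup I_{i_k}|\ge a_{i_1}+\cdots+a_{i_k}+1$. Raising powers: $(y)_a=y(y+1)\cdots(y+a-1)$ for $a\ge1$, and $(y)_0=1$. *)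

theory Defs
  imports "HOL-Analysis.Analysis"
begin

text \<open>
  The right vertices, i.e. the set \<open>[n]\<close>, are the elements of a finite type \<open>'n\<close>, so that
  \<open>n = CARD('n)\<close>, \<open>[n] = UNIV\<close>, and the ambient space is \<open>real ^ 'n\<close>. The left vertices
  are the numbers in \<open>{1..m}\<close>. A subgraph of \<open>K\<^sub>m\<^sub>,\<^sub>n\<close> is given by its set of edges.
\<close>

definition bipartite_subgraph :: "nat \<Rightarrow> (nat \<times> 'n::finite) set \<Rightarrow> bool" where
  "bipartite_subgraph m G \<longleftrightarrow> G \<subseteq> {1..m} \<times> UNIV"

definition no_isolated_vertices :: "nat \<Rightarrow> (nat \<times> 'n::finite) set \<Rightarrow> bool" where
  "no_isolated_vertices m G \<longleftrightarrow>
     (\<forall>i\<in>{1..m}. \<exists>j. (i, j) \<in> G) \<and> (\<forall>j. \<exists>i\<in>{1..m}. (i, j) \<in> G)"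

definition assoc_set :: "(nat \<times> 'n::finite) set \<Rightarrow> nat \<Rightarrow> 'n set" where
  "assoc_set G i = {j. (i, j) \<in> G}"

definition coord_simplex :: "'n::finite set \<Rightarrow> (real ^ 'n) set" where
  "coord_simplex I = convex hull ((\<lambda>i. axis i 1) ` I)"

text \<open>The sum below is the Minkowski sum of sets from \<open>HOL-Library.Set_Algebras\<close>.\<close>

definition gen_permutohedron ::
  "nat \<Rightarrow> (nat \<times> 'n::finite) set \<Rightarrow> (nat \<Rightarrow> real) \<Rightarrow> (real ^ 'n) set" where
  "gen_permutohedron m G y = (\<Sum>i=1..m. (\<lambda>x. y i *\<^sub>R x) ` coord_simplex (assoc_set G i))"

definition trimmed_gen_permutohedron ::
  "nat \<Rightarrow> (nat \<times> 'n::finite) set \<Rightarrow> (nat \<Rightarrow> real) \<Rightarrow> (real ^ 'n) set" where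
  "trimmed_gen_permutohedron m G y =
     {x. (\<lambda>v. x + v) ` coord_simplex UNIV \<subseteq> gen_permutohedron m G y}"

definition integer_lattice :: "(real ^ 'n::finite) set" where
  "integer_lattice = {x. \<forall>j. x $ j \<in> \<int>}"

text \<open>
  Sequences \<open>(a\<^sub>1, \<dots>, a\<^sub>m)\<close> are extensional functions on \<open>{1..m}\<close>, so that each sequence is
  represented exactly once.
\<close>

definition draconian_seqs :: "nat \<Rightarrow> (nat \<times> 'n::finite) set \<Rightarrow> (nat \<Rightarrow> nat) set" where
  "draconian_seqs m G =
     {a \<in> {1..m} \<rightarrow>\<^sub>E UNIV. (\<Sum>i=1..m. a i) = CARD('n) - 1 \<and>
        (\<forall>J. J \<subseteq> {1..m} \<and> J \<noteq> {} \<longrightarrow> card (\<Union>i\<in>J. assoc_set G i) \<ge> (\<Sum>i\<in>J. a i) + 1)}"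

lemma finite_draconian_seqs: "finite (draconian_seqs m (G :: (nat \<times> 'n::finite) set))"
proof (rule finite_subset)
  show "draconian_seqs m G \<subseteq> {1..m} \<rightarrow>\<^sub>E {..CARD('n) - 1}"
  proof
    fix a assume "a \<in> draconian_seqs m G"
    then have ext: "a \<in> {1..m} \<rightarrow>\<^sub>E UNIV" and sum: "(\<Sum>i=1..m. a i) = CARD('n) - 1"
      by (auto simp: draconian_seqs_def)
    have "a i \<le> CARD('n) - 1" if "i \<in> {1..m}" for i
      using member_le_sum[OF that, of a] sum by simp
    with ext show "a \<in> {1..m} \<rightarrow>\<^sub>E {..CARD('n) - 1}"
      by (auto simp: PiE_iff)
  qed
  show "finite ({1..m} \<rightarrow>\<^sub>E {..CARD('n) - 1})"
    by (intro finite_PiE) auto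
qed

end

theory Submission
  imports Defs "HOL-Library.Equipollence"
begin

text \<open>
  Replacing the left vertex \<open>i\<close> by \<open>y i\<close> copies reduces the count to weights \<open>1\<close>: for a bipartite
  graph with parts \<open>L\<close> and \<open>R\<close>, the lattice points of the trimmed polytope are the integer vectors
  \<open>x\<close> on \<open>R\<close> with \<open>x(S) < |\<Gamma>(S)|\<close> for all nonempty \<open>S\<close> and \<open>x(R) = |L| - 1\<close>, while the draconian
  sequences are the vectors obtained in this way after exchanging the parts. Both numbers satisfy
  the same recursion. Fix an edge \<open>(i, j)\<close>, let \<open>D\<close> be the largest set avoiding \<open>j\<close> with
  \<open>x(D) = |\<Gamma>(D) \<union> {i}| - 1\<close>, and let \<open>C = \<Gamma>(D) \<union> {i}\<close>. Then \<open>x\<close> restricts to such a vector for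
  the subgraph on \<open>C, D\<close>, and \<open>x - e\<^sub>j\<close> to one for the subgraph on the complements; the pairs
  \<open>(C, D)\<close> range over all cuts separating \<open>i\<close> from \<open>j\<close> without edges from \<open>L - C\<close> to \<open>D\<close>, a
  condition invariant under exchanging the parts. (Geometrically, this is the pulling triangulation
  of the root polytope at the vertex \<open>(i, j)\<close>.) The factors \<open>(y\<^sub>i)\<^sub>a / a!\<close> count the ways to distribute
  \<open>a\<close> over the \<open>y\<^sub>i\<close> copies of \<open>i\<close>.
\<close>

section \<open>Hypertrees and their duality\<close>

text \<open>
  For a connected graph these are the right degree vectors of its spanning trees, each entry
  decreased by one. Integer entries matter in degenerate cases: an isolated right vertex alone gives
  the vector with entry \<open>-1\<close>, as its degree is \<open>0\<close>.
\<close>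

definition hypertrees :: "'a set \<Rightarrow> 'b set \<Rightarrow> ('a \<times> 'b) set \<Rightarrow> ('b \<Rightarrow> int) set" where
  "hypertrees L R E = {x \<in> R \<rightarrow>\<^sub>E UNIV.
     (\<forall>S. S \<subseteq> R \<and> S \<noteq> {} \<longrightarrow> sum x S < int (card (E\<inverse> `` S \<inter> L))) \<and>
     sum x R = int (card L) - 1}"

lemma hypertreesI:
  assumes "x \<in> R \<rightarrow>\<^sub>E UNIV"
    and "\<And>S. S \<subseteq> R \<Longrightarrow> S \<noteq> {} \<Longrightarrow> sum x S < int (card (E\<inverse> `` S \<inter> L))"
    and "sum x R = int (card L) - 1"
  shows "x \<in> hypertrees L R E"
  using assms by (simp add: hypertrees_def)

lemma hypertreesD:
  assumes "x \<in> hypertrees L R E"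
  shows "x \<in> R \<rightarrow>\<^sub>E UNIV"
    and "S \<subseteq> R \<Longrightarrow> S \<noteq> {} \<Longrightarrow> sum x S < int (card (E\<inverse> `` S \<inter> L))"
    and "sum x R = int (card L) - 1"
  using assms by (auto simp: hypertrees_def)

section \<open>Cutting and gluing hypertrees along an edge\<close>

definition edge_cuts :: "'a \<Rightarrow> 'b \<Rightarrow> 'a set \<Rightarrow> 'b set \<Rightarrow> ('a \<times> 'b) set \<Rightarrow> ('a set \<times> 'b set) set" where
  "edge_cuts i j L R E =
     {(C, D). i \<in> C \<and> C \<subseteq> L \<and> D \<subseteq> R - {j} \<and> E\<inverse> `` D \<inter> L \<subseteq> C}"

text \<open>The unit added at \<open>j\<close> pays for the edge \<open>(i, j)\<close> between
  \<open>C\<close> and \<open>R - D\<close>: the totals \<open>|C| - 1\<close> and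
  \<open>|L - C| - 1\<close> fall one short of \<open>|L| - 1\<close>.\<close>

definition glue :: "'b \<Rightarrow> 'b set \<Rightarrow> 'b set \<Rightarrow> ('b \<Rightarrow> int) \<Rightarrow> ('b \<Rightarrow> int) \<Rightarrow> 'b \<Rightarrow> int" where
  "glue j R D x z = (\<lambda>k\<in>R. if k \<in> D then x k else z k + of_bool (k = j))"

lemma sum_glue:
  assumes "finite R" "S \<subseteq> R" "j \<notin> D"
  shows "sum (glue j R D x z) S = sum x (S \<inter> D) + sum z (S - D) + of_bool (j \<in> S)"
proof -
  have fin: "finite S" using assms finite_subset by blast
  have "sum (glue j R D x z) S
      = (\<Sum>k\<in>S. (if k \<in> D then x k else z k) + (if k = j then 1 else 0))"
    using assms by (intro sum.cong) (auto simp: glue_def)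
  also have "\<dots> = (\<Sum>k\<in>S. if k \<in> D then x k else z k) + of_bool (j \<in> S)"
    using fin by (simp add: sum.distrib sum.delta)
  also have "(\<Sum>k\<in>S. if k \<in> D then x k else z k) = sum x (S \<inter> D) + sum z (S - D)"
    using fin by (simp add: sum.If_cases Diff_eq)
  finally show ?thesis .
qed

text \<open>Neighbours of a set split into those in \<open>C\<close>, which bound \<open>x\<close>,
  and those in \<open>L - C\<close>, which bound \<open>z\<close>; of the two strict inequalities
  one is spare and absorbs the unit at \<open>j\<close>. The last three conclusions make
  \<open>(C, D)\<close> recoverable: \<open>D\<close> is tight for the bound
  \<open>|\<Gamma>(S) \<union> {i}| - 1\<close>, no proper superset avoiding \<open>j\<close> is,
  and \<open>D\<close> determines \<open>C\<close>.\<close>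

lemma glue_hypertree:
  assumes fin: "finite L" "finite R" and ij: "(i, j) \<in> E" "i \<in> L" "j \<in> R"
    and CD: "(C, D) \<in> edge_cuts i j L R E"
    and x: "x \<in> hypertrees C D E" and z: "z \<in> hypertrees (L - C) (R - D) E"
  shows "glue j R D x z \<in> hypertrees L R E"
    and "sum (glue j R D x z) D = int (card (E\<inverse> `` D \<inter> L \<union> {i})) - 1"
    and "C = E\<inverse> `` D \<inter> L \<union> {i}"
    and "\<And>S. D \<subset> S \<Longrightarrow> S \<subseteq> R - {j} \<Longrightarrow>
      sum (glue j R D x z) S < int (card (E\<inverse> `` S \<inter> L \<union> {i})) - 1"
proof -
  have cd: "i \<in> C" "C \<subseteq> L" "D \<subseteq> R" "j \<notin> D" "E\<inverse> `` D \<inter> L \<subseteq> C"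
    using CD by (auto simp: edge_cuts_def)
  have finC: "finite C" using cd fin finite_subset by blast
  have cardL: "int (card L) = int (card C) + int (card (L - C))"
    using cd fin finC by (simp add: card_Diff_subset card_mono)
  have low: "sum z S < int (card (E\<inverse> `` S \<inter> (L - C)))" if "S \<subseteq> R - D" "S \<noteq> {}" for S
    using hypertreesD(2)[OF z that] .
  have up: "sum x S < int (card (E\<inverse> `` S \<inter> L))" if "S \<subseteq> D" "S \<noteq> {}" for S
  proof -
    have "E\<inverse> `` S \<inter> C \<subseteq> E\<inverse> `` S \<inter> L" using cd by auto
    then have "card (E\<inverse> `` S \<inter> C) \<le> card (E\<inverse> `` S \<inter> L)"
      using fin by (intro card_mono) auto
    then show ?thesis using hypertreesD(2)[OF x that] by linarith
  qed
  show "glue j R D x z \<in> hypertrees L R E"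
  proof (rule hypertreesI)
    show "glue j R D x z \<in> R \<rightarrow>\<^sub>E UNIV" by (auto simp: glue_def)
    show "sum (glue j R D x z) R = int (card L) - 1"
      using sum_glue[OF fin(2) order_refl cd(4), of x z] ij(3) cd(3) cardL
        hypertreesD(3)[OF x] hypertreesD(3)[OF z] by (simp add: Int_absorb1)
    fix S assume S: "S \<subseteq> R" "S \<noteq> {}"
    have eq: "sum (glue j R D x z) S = sum x (S \<inter> D) + sum z (S - D) + of_bool (j \<in> S)"
      using sum_glue[OF fin(2) S(1) cd(4)] .
    have split: "card (E\<inverse> `` S \<inter> L) = card (E\<inverse> `` S \<inter> C) + card (E\<inverse> `` S \<inter> (L - C))"
    proof -
      have "E\<inverse> `` S \<inter> L = (E\<inverse> `` S \<inter> C) \<union> (E\<inverse> `` S \<inter> (L - C))" using cd by auto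
      then show ?thesis using fin finC by (auto intro!: card_Un_disjoint)
    qed
    have m1: "card (E\<inverse> `` (S - D) \<inter> (L - C)) \<le> card (E\<inverse> `` S \<inter> (L - C))"
      using fin by (intro card_mono) auto
    have m2: "card (E\<inverse> `` (S \<inter> D) \<inter> C) \<le> card (E\<inverse> `` S \<inter> C)"
      using finC by (intro card_mono) auto
    \<comment> \<open>When \<open>S\<close> misses \<open>D\<close>, the unit at \<open>j\<close>
      uses up the strictness for \<open>z\<close>; then \<open>i\<close> itself is an extra
      neighbour in \<open>C\<close>.\<close>
    have m3: "j \<in> S \<Longrightarrow> card (E\<inverse> `` S \<inter> C) > 0"
      using ij cd finC by (auto simp: card_gt_0_iff)
    have zb: "sum z (S - D) + of_bool (j \<in> S) \<le> int (card (E\<inverse> `` S \<inter> (L - C)))"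
    proof (cases "S - D = {}")
      case True
      then have "j \<notin> S" using cd by auto
      then show ?thesis unfolding True by simp
    next
      case False
      have "S - D \<subseteq> R - D" using S by auto
      from low[OF this False] m1 show ?thesis by (cases "j \<in> S") auto
    qed
    show "sum (glue j R D x z) S < int (card (E\<inverse> `` S \<inter> L))"
    proof (cases "S \<inter> D = {}")
      case True
      then have "S - D = S" by auto
      then have "sum z S < int (card (E\<inverse> `` S \<inter> (L - C)))" using low[of S] S by auto
      then show ?thesis using eq True \<open>S - D = S\<close> split m3 by auto
    next
      case False
      then have "sum x (S \<inter> D) < int (card (E\<inverse> `` (S \<inter> D) \<inter> C))"
        by (intro hypertreesD(2)[OF x]) auto
      then show ?thesis using eq zb split m2 by linarith
    qed
  qed
  \<comment> \<open>For empty \<open>D\<close> the total \<open>0 = |C| - 1\<close> leaves only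
    \<open>i\<close>. Otherwise \<open>x(D) = |C| - 1\<close> and strictness on \<open>D\<close>
    force at least \<open>|C|\<close> neighbours, all of them in \<open>C\<close>.\<close>
  show C: "C = E\<inverse> `` D \<inter> L \<union> {i}"
  proof (cases "D = {}")
    case True
    then have "card C = 1" using hypertreesD(3)[OF x] by simp
    then show ?thesis using True cd by (auto simp: card_1_singleton_iff)
  next
    case False
    then have "card (E\<inverse> `` D \<inter> L) \<ge> card C" using up[of D] hypertreesD(3)[OF x] by simp
    then have "E\<inverse> `` D \<inter> L = C" using cd finC by (simp add: card_seteq)
    then show ?thesis using cd by auto
  qed
  have eqD: "sum (glue j R D x z) D = sum x D"
    using sum_glue[OF fin(2) cd(3,4)] cd by simp
  show "sum (glue j R D x z) D = int (card (E\<inverse> `` D \<inter> L \<union> {i})) - 1"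
    using eqD hypertreesD(3)[OF x] C by simp
  show "sum (glue j R D x z) S < int (card (E\<inverse> `` S \<inter> L \<union> {i})) - 1"
    if S: "D \<subset> S" "S \<subseteq> R - {j}" for S
  proof -
    have "S \<subseteq> R" "j \<notin> S" "S \<inter> D = D" using S by auto
    then have "sum (glue j R D x z) S = sum x D + sum z (S - D)"
      using sum_glue[OF fin(2) _ cd(4), of S x z] by simp
    moreover have "sum z (S - D) < int (card (E\<inverse> `` (S - D) \<inter> (L - C)))"
      using S by (intro low) auto
    moreover have "card C + card (E\<inverse> `` (S - D) \<inter> (L - C))
        = card (C \<union> (E\<inverse> `` (S - D) \<inter> (L - C)))"
      using finC fin by (intro card_Un_disjoint[symmetric]) auto
    moreover have "C \<union> (E\<inverse> `` (S - D) \<inter> (L - C)) = E\<inverse> `` S \<inter> L \<union> {i}"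
      using cd ij C S by auto
    ultimately show ?thesis using hypertreesD(3)[OF x] by simp
  qed
qed

text \<open>Uncrossing: as \<open>sum x\<close> is modular and \<open>g\<close> submodular,
  tightness of \<open>S\<close> and \<open>T\<close> forces tightness of
  \<open>S \<union> T\<close>. The empty set is tight, so the union of all tight sets is tight and
  the largest.\<close>

lemma maximal_tight_set:
  fixes x :: "'b \<Rightarrow> int" and g :: "'b set \<Rightarrow> nat"
  assumes "finite V" and "g {} = 0"
    and sub: "\<And>S T. S \<subseteq> V \<Longrightarrow> T \<subseteq> V \<Longrightarrow> g (S \<union> T) + g (S \<inter> T) \<le> g S + g T"
    and le: "\<And>S. S \<subseteq> V \<Longrightarrow> sum x S \<le> int (g S)"
  obtains D where "D \<subseteq> V" "sum x D = int (g D)"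
    "\<And>S. S \<subseteq> V \<Longrightarrow> sum x S = int (g S) \<Longrightarrow> S \<subseteq> D"
proof -
  let ?F = "{S. S \<subseteq> V \<and> sum x S = int (g S)}"
  have fin: "finite ?F" using assms(1) by auto
  have "S \<union> T \<in> ?F" if "S \<in> ?F" "T \<in> ?F" for S T
  proof -
    have "finite S" "finite T" using that assms(1) finite_subset by blast+
    then have "sum x (S \<union> T) + sum x (S \<inter> T) = sum x S + sum x T"
      by (rule sum.union_inter)
    with that sub[of S T] le[of "S \<union> T"] le[of "S \<inter> T"] show ?thesis
      by (auto simp: le_infI1)
  qed
  moreover have "{} \<in> ?F" using assms(2) by simp
  ultimately have "\<Union>?F \<in> ?F" using fin by (intro finite_Sup_in) auto
  then show ?thesis by (intro that[of "\<Union>?F"]) auto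
qed

text \<open>The bound \<open>g S = |\<Gamma>(S) \<union> {i}| - 1\<close> is a coverage function
  lowered by one. Adjoining \<open>i\<close> keeps the set nonempty, so natural subtraction is
  exact, and gives \<open>g {} = 0\<close>. The hypertree inequality, being strict, yields
  \<open>sum x S \<le> g S\<close>.\<close>

lemma hypertree_maximal_tight_set:
  assumes fin: "finite L" "finite R" and x: "x \<in> hypertrees L R E"
  obtains D where "D \<subseteq> R - {j}" "sum x D = int (card (E\<inverse> `` D \<inter> L \<union> {i})) - 1"
    "\<And>S. S \<subseteq> R - {j} \<Longrightarrow> sum x S = int (card (E\<inverse> `` S \<inter> L \<union> {i})) - 1 \<Longrightarrow> S \<subseteq> D"
proof -
  define h where "h S = E\<inverse> `` S \<inter> L \<union> {i}" for S
  have finh: "finite (h S)" for S using fin by (simp add: h_def)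
  have pos: "card (h S) > 0" for S using finh[of S] by (auto simp: card_gt_0_iff h_def)
  obtain D where "D \<subseteq> R - {j}" "sum x D = int (card (h D) - 1)"
    "\<And>S. S \<subseteq> R - {j} \<Longrightarrow> sum x S = int (card (h S) - 1) \<Longrightarrow> S \<subseteq> D"
  proof (rule maximal_tight_set[of "R - {j}" "\<lambda>S. card (h S) - 1" x])
    show "card (h (S \<union> T)) - 1 + (card (h (S \<inter> T)) - 1) \<le> card (h S) - 1 + (card (h T) - 1)"
      for S T
    proof -
      have "h (S \<union> T) = h S \<union> h T" by (auto simp: h_def)
      then have "card (h (S \<union> T)) + card (h S \<inter> h T) = card (h S) + card (h T)"
        using card_Un_Int[OF finh finh] by simp
      moreover have "card (h (S \<inter> T)) \<le> card (h S \<inter> h T)"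
        using finh by (intro card_mono) (auto simp: h_def)
      moreover have "card (h (S \<union> T)) > 0" by (rule pos)
      ultimately show ?thesis using pos[of S] pos[of T] pos[of "S \<inter> T"] by linarith
    qed
    show "sum x S \<le> int (card (h S) - 1)" if "S \<subseteq> R - {j}" for S
    proof (cases "S = {}")
      case False
      have "card (E\<inverse> `` S \<inter> L) \<le> card (h S)" using finh by (intro card_mono) (auto simp: h_def)
      moreover have "S \<subseteq> R" using that by auto
      ultimately show ?thesis using False hypertreesD(2)[OF x, of S] pos[of S] by simp
    qed simp
  qed (use fin in \<open>auto simp: h_def\<close>)
  moreover have "int (card (h S) - 1) = int (card (E\<inverse> `` S \<inter> L \<union> {i})) - 1" for S
    using pos[of S] by (simp add: h_def of_nat_diff)
  ultimately show ?thesis by (intro that[of D]) simp_all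
qed

text \<open>\<open>D\<close> is taken as the largest tight set, \<open>C\<close> as its
  neighbourhood together with \<open>i\<close>, and \<open>z\<close> as the rest of \<open>x\<close>
  with the unit at \<open>j\<close> removed. Maximality of \<open>D\<close> makes the inequalities
  for \<open>z\<close> strict.\<close>

lemma hypertree_unglue:
  assumes fin: "finite L" "finite R" and ij: "i \<in> L" "j \<in> R"
    and x: "x \<in> hypertrees L R E"
  obtains C D x' z where "(C, D) \<in> edge_cuts i j L R E"
    "x' \<in> hypertrees C D E" "z \<in> hypertrees (L - C) (R - D) E" "x = glue j R D x' z"
proof -
  obtain D where D: "D \<subseteq> R - {j}" "sum x D = int (card (E\<inverse> `` D \<inter> L \<union> {i})) - 1"
    and max: "\<And>S. S \<subseteq> R - {j} \<Longrightarrow> sum x S = int (card (E\<inverse> `` S \<inter> L \<union> {i})) - 1 \<Longrightarrow> S \<subseteq> D"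
    by (rule hypertree_maximal_tight_set[OF fin x, where i = i and j = j]) blast
  define C where "C = E\<inverse> `` D \<inter> L \<union> {i}"
  define z where "z = (\<lambda>k\<in>R - D. x k - of_bool (k = j))"
  have C: "C \<subseteq> L" "finite C" using ij fin by (auto simp: C_def)
  have finD: "finite D" using D fin by (meson finite_Diff finite_subset)
  have cut: "(C, D) \<in> edge_cuts i j L R E"
    using D ij by (auto simp: edge_cuts_def C_def)
  \<comment> \<open>Without \<open>j\<close>, a proper superset of \<open>D\<close> is not tight,
    which improves the weak bound by one; with \<open>j\<close>, the unit to be removed supplies
    that gain.\<close>
  have le: "sum x S < int (card (E\<inverse> `` S \<inter> L \<union> {i})) - 1 + of_bool (j \<in> S)"
    if "D \<subset> S" "S \<subseteq> R" for S
  proof -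
    have "sum x S < int (card (E\<inverse> `` S \<inter> L))"
      using hypertreesD(2)[OF x, of S] that by auto
    moreover have "card (E\<inverse> `` S \<inter> L) \<le> card (E\<inverse> `` S \<inter> L \<union> {i})"
      using fin by (intro card_mono) auto
    moreover have "sum x S \<noteq> int (card (E\<inverse> `` S \<inter> L \<union> {i})) - 1" if "j \<notin> S"
      using max[of S] that \<open>D \<subset> S\<close> \<open>S \<subseteq> R\<close> by auto
    ultimately show ?thesis by (cases "j \<in> S") auto
  qed
  have sumz: "sum z S = sum x (D \<union> S) - sum x D - of_bool (j \<in> S)" if "S \<subseteq> R - D" for S
  proof -
    have finS: "finite S" using that fin by (meson finite_Diff finite_subset)
    have "sum z S = (\<Sum>k\<in>S. x k - (if k = j then 1 else 0))"
      using that by (intro sum.cong) (auto simp: z_def)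
    also have "\<dots> = sum x S - of_bool (j \<in> S)"
      using finS by (simp add: sum_subtractf sum.delta)
    finally have "sum z S = sum x S - of_bool (j \<in> S)" .
    moreover have "sum x (D \<union> S) = sum x D + sum x S"
      using that finS finD by (intro sum.union_disjoint) auto
    ultimately show ?thesis by simp
  qed
  have "restrict x D \<in> hypertrees C D E"
  proof (rule hypertreesI)
    show "sum (restrict x D) D = int (card C) - 1" using D by (simp add: C_def)
    fix S assume S: "S \<subseteq> D" "S \<noteq> {}"
    have "sum (restrict x D) S = sum x S" using S by (intro sum.cong) auto
    moreover have "card (E\<inverse> `` S \<inter> L) \<le> card (E\<inverse> `` S \<inter> C)"
      using S C by (intro card_mono) (auto simp: C_def)
    ultimately show "sum (restrict x D) S < int (card (E\<inverse> `` S \<inter> C))"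
      using hypertreesD(2)[OF x, of S] S D(1) by fastforce
  qed auto
  moreover have "z \<in> hypertrees (L - C) (R - D) E"
  proof (rule hypertreesI)
    show "z \<in> R - D \<rightarrow>\<^sub>E UNIV" by (auto simp: z_def)
    have "D \<union> (R - D) = R" using D by auto
    moreover have "int (card L) = int (card C) + int (card (L - C))"
      using C fin by (simp add: card_Diff_subset card_mono)
    ultimately show "sum z (R - D) = int (card (L - C)) - 1"
      using sumz[of "R - D"] hypertreesD(3)[OF x] D ij by (simp add: C_def subset_Diff_insert)
    fix S assume S: "S \<subseteq> R - D" "S \<noteq> {}"
    have DS: "D \<subset> D \<union> S" "D \<union> S \<subseteq> R" "j \<notin> D" using S D(1) by auto
    \<comment> \<open>Only neighbours outside \<open>C\<close> are new, so subtracting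
      \<open>x(D) = |C| - 1\<close> from the bound for \<open>D \<union> S\<close> leaves the bound
      for \<open>z\<close> on \<open>S\<close>.\<close>
    have "E\<inverse> `` (D \<union> S) \<inter> L \<union> {i} = C \<union> (E\<inverse> `` S \<inter> (L - C))"
      by (auto simp: C_def)
    also have "card \<dots> = card C + card (E\<inverse> `` S \<inter> (L - C))"
      using C fin by (intro card_Un_disjoint) auto
    finally show "sum z S < int (card (E\<inverse> `` S \<inter> (L - C)))"
      using sumz[OF S(1)] le[of "D \<union> S"] D(2) DS
      by (simp add: C_def)
  qed
  moreover have "x = glue j R D (restrict x D) z"
    using hypertreesD(1)[OF x] D by (auto simp: glue_def z_def PiE_iff extensional_def fun_eq_iff)
  ultimately show ?thesis using cut that by blast
qed

text \<open>Gluing is the bijection. It is injective because the largest tight set of a glued vector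
  returns \<open>D\<close>, hence \<open>C\<close>, and then \<open>x\<close> and \<open>z\<close>
  are read off pointwise, both being \<open>undefined\<close> off their domains.\<close>

lemma hypertrees_eqpoll_edge_cuts:
  assumes fin: "finite L" "finite R" and ij: "(i, j) \<in> E" "i \<in> L" "j \<in> R"
  shows "hypertrees L R E \<approx> (SIGMA p : edge_cuts i j L R E.
    hypertrees (fst p) (snd p) E \<times> hypertrees (L - fst p) (R - snd p) E)"
    (is "_ \<approx> Sigma ?P ?H")
proof -
  let ?\<phi> = "\<lambda>(p, x, z). glue j R (snd p) x z"
  have "inj_on ?\<phi> (Sigma ?P ?H)"
  proof (rule inj_onI, clarsimp)
    fix C D C' D' x z x' z'
    assume CD: "(C, D) \<in> ?P" "x \<in> hypertrees C D E" "z \<in> hypertrees (L - C) (R - D) E"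
      and CD': "(C', D') \<in> ?P" "x' \<in> hypertrees C' D' E" "z' \<in> hypertrees (L - C') (R - D') E"
      and eq: "glue j R D x z = glue j R D' x' z'"
    note g = glue_hypertree[OF fin ij CD] and g' = glue_hypertree[OF fin ij CD']
    obtain M where M: "M \<subseteq> R - {j}"
        "sum (glue j R D x z) M = int (card (E\<inverse> `` M \<inter> L \<union> {i})) - 1"
      and max: "\<And>S. S \<subseteq> R - {j} \<Longrightarrow>
        sum (glue j R D x z) S = int (card (E\<inverse> `` S \<inter> L \<union> {i})) - 1 \<Longrightarrow> S \<subseteq> M"
      by (rule hypertree_maximal_tight_set[OF fin g(1), where i = i and j = j]) blast
    have sub: "D \<subseteq> R - {j}" "D' \<subseteq> R - {j}" using CD CD' by (auto simp: edge_cuts_def)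
    have "D = M" using max[OF sub(1) g(2)] g(4)[of M] M by (auto simp: psubset_eq)
    moreover have "D' = M" using max[OF sub(2)] g'(2) g'(4)[of M] M eq by (auto simp: psubset_eq)
    ultimately have D: "D' = D" by simp
    moreover have "C' = C" using g(3) g'(3) D by simp
    moreover have "x k = x' k" for k
      using fun_cong[OF eq, of k] sub D hypertreesD(1)[OF CD(2)] hypertreesD(1)[OF CD'(2)]
      by (cases "k \<in> D") (auto simp: glue_def PiE_iff extensional_def)
    moreover have "z k = z' k" for k
      using fun_cong[OF eq, of k] sub D hypertreesD(1)[OF CD(3)] hypertreesD(1)[OF CD'(3)]
      by (cases "k \<in> R - D") (auto simp: glue_def PiE_iff extensional_def)
    ultimately show "C = C' \<and> D = D' \<and> x = x' \<and> z = z'" by auto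
  qed
  moreover have "?\<phi> ` Sigma ?P ?H = hypertrees L R E"
  proof
    show "?\<phi> ` Sigma ?P ?H \<subseteq> hypertrees L R E"
      using glue_hypertree(1)[OF fin ij] by auto
    show "hypertrees L R E \<subseteq> ?\<phi> ` Sigma ?P ?H"
    proof
      fix x assume "x \<in> hypertrees L R E"
      from hypertree_unglue[OF fin ij(2,3) this] obtain C D x' z
        where "(C, D) \<in> edge_cuts i j L R E" "x' \<in> hypertrees C D E"
          "z \<in> hypertrees (L - C) (R - D) E" "x = glue j R D x' z" by blast
      then show "x \<in> ?\<phi> ` Sigma ?P ?H"
        by (intro image_eqI[of _ _ "((C, D), x', z)"]) auto
    qed
  qed
  ultimately have "bij_betw ?\<phi> (Sigma ?P ?H) (hypertrees L R E)"
    by (simp add: bij_betw_def)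
  then show ?thesis using eqpoll_def eqpoll_sym by blast
qed

section \<open>Exchanging the two parts of the graph\<close>

text \<open>Base of the recursion. All neighbourhoods are empty, so nonempty sets have negative
  sums; together with the total \<open>|L| - 1\<close> this leaves one vector if the graph is a
  single vertex, on whichever side, and none otherwise.\<close>

lemma hypertrees_no_edges:
  assumes fin: "finite L" "finite R" and none: "\<And>i j. i \<in> L \<Longrightarrow> j \<in> R \<Longrightarrow> (i, j) \<notin> E"
  shows "hypertrees L R E \<approx> {..<of_bool (card L + card R = 1) :: nat}"
proof -
  have G: "E\<inverse> `` S \<inter> L = {}" if "S \<subseteq> R" for S using that none by auto
  consider "R = {}" | j where "R = {j}" | j k where "j \<in> R" "k \<in> R" "j \<noteq> k" by blast
  then show ?thesis
  proof cases
    case 1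
    then have "hypertrees L R E = (if card L = 1 then {\<lambda>_. undefined} else {})"
      by (auto simp: hypertrees_def)
    then show ?thesis using 1 by (auto simp: eqpoll_iff_finite_card)
  next
    case 2
    have "x j < 0" if "x \<in> hypertrees L R E" for x
      using hypertreesD(2)[OF that, of "{j}"] G[of "{j}"] 2 by simp
    moreover have "x j = int (card L) - 1" if "x \<in> hypertrees L R E" for x
      using hypertreesD(3)[OF that] 2 by simp
    moreover have "hypertrees L R E = {\<lambda>k\<in>R. -1}" if "card L = 0"
    proof -
      have "L = {}" using fin that by simp
      have "x \<in> hypertrees L R E \<longleftrightarrow> x = (\<lambda>k\<in>R. -1)" for x
      proof
        assume "x \<in> hypertrees L R E"
        then have "x \<in> R \<rightarrow>\<^sub>E UNIV" "sum x R = -1"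
          using \<open>L = {}\<close> by (simp_all add: hypertrees_def)
        then show "x = (\<lambda>k\<in>R. -1)"
          using 2 by (auto simp: PiE_iff extensional_def)
      next
        assume x: "x = (\<lambda>k\<in>R. -1)"
        show "x \<in> hypertrees L R E"
        proof (rule hypertreesI)
          fix S assume "S \<subseteq> R" "S \<noteq> {}"
          then have "S = {j}" using 2 by auto
          then show "sum x S < int (card (E\<inverse> `` S \<inter> L))" using x 2 by simp
        qed (use x 2 \<open>L = {}\<close> in auto)
      qed
      then show ?thesis by auto
    qed
    ultimately have "hypertrees L R E = (if card L = 0 then {\<lambda>k\<in>R. -1} else {})"
      by fastforce
    then show ?thesis using 2 by (auto simp: eqpoll_iff_finite_card)
  next
    case 3
    have "hypertrees L R E = {}"
    proof (rule ccontr)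
      assume "hypertrees L R E \<noteq> {}"
      then obtain x where x: "x \<in> hypertrees L R E" by auto
      \<comment> \<open>Two disjoint nonempty parts of \<open>R\<close>, each of sum at most
        \<open>-1\<close>, push the total below \<open>|L| - 1 \<ge> -1\<close>.\<close>
      have "sum x (R - {j}) < 0"
        using hypertreesD(2)[OF x, of "R - {j}"] G[of "R - {j}"] 3 by auto
      moreover have "x j < 0"
        using hypertreesD(2)[OF x, of "{j}"] G[of "{j}"] 3 by auto
      moreover have "sum x R = x j + sum x (R - {j})"
        using 3 fin by (simp add: sum.remove)
      ultimately show False using hypertreesD(3)[OF x] by simp
    qed
    moreover have "card R \<ge> 2"
      using 3 fin card_mono[of R "{j, k}"] by simp
    ultimately show ?thesis by simp
  qed
qed

text \<open>Induction on the number of vertices, both sides being decomposed at the same edge. The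
  cut \<open>(C, D)\<close> corresponds to \<open>(R - D, L - C)\<close> for the reversed edge,
  which interchanges the two factors.\<close>

lemma hypertrees_converse_eqpoll:
  assumes "finite L" "finite R"
  shows "hypertrees L R E \<approx> hypertrees R L (E\<inverse>)"
  using assms
proof (induction "card L + card R" arbitrary: L R rule: less_induct)
  case less
  note fin = less.prems
  show ?case
  proof (cases "\<exists>i j. i \<in> L \<and> j \<in> R \<and> (i, j) \<in> E")
    case False
    then have "hypertrees L R E \<approx> {..<of_bool (card L + card R = 1) :: nat}"
      using fin by (intro hypertrees_no_edges) auto
    moreover have "hypertrees R L (E\<inverse>) \<approx> {..<of_bool (card R + card L = 1) :: nat}"
      using False fin by (intro hypertrees_no_edges) auto
    ultimately show ?thesis
      by (metis add.commute eqpoll_sym eqpoll_trans)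
  next
    case True
    then obtain i j where ij: "i \<in> L" "j \<in> R" "(i, j) \<in> E" by blast
    let ?c = "\<lambda>p. (R - snd p, L - fst p)"
    have "hypertrees L R E \<approx> (SIGMA p : edge_cuts i j L R E.
        hypertrees (fst p) (snd p) E \<times> hypertrees (L - fst p) (R - snd p) E)"
      using fin ij by (intro hypertrees_eqpoll_edge_cuts) auto
    also have "\<dots> \<approx> (SIGMA p : edge_cuts j i R L (E\<inverse>).
        hypertrees (fst p) (snd p) (E\<inverse>) \<times> hypertrees (R - fst p) (L - snd p) (E\<inverse>))"
    proof (rule Sigma_eqpoll_cong)
      show "bij_betw ?c (edge_cuts i j L R E) (edge_cuts j i R L (E\<inverse>))"
        by (rule bij_betw_byWitness[where f' = "\<lambda>p. (L - snd p, R - fst p)"])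
          (use ij in \<open>(auto simp: edge_cuts_def; blast)+\<close>)
      fix p assume "p \<in> edge_cuts i j L R E"
      then obtain C D where p: "p = (C, D)" "i \<in> C" "C \<subseteq> L" "D \<subseteq> R - {j}"
        by (auto simp: edge_cuts_def)
      \<comment> \<open>The recursion descends because \<open>j\<close> is missing from
        \<open>D\<close> here and \<open>i\<close> is missing from \<open>L - C\<close>
        below.\<close>
      have CD: "finite C" "finite D" "card C \<le> card L" "card D < card R"
        using p fin ij
        by (auto intro: finite_subset card_mono psubset_card_mono)
      have "hypertrees C D E \<approx> hypertrees D C (E\<inverse>)"
        using CD by (intro less.hyps) auto
      moreover have "card (L - C) < card L" "card (R - D) \<le> card R"
        using p fin ij by (auto intro!: card_mono psubset_card_mono)
      then have "hypertrees (L - C) (R - D) E \<approx> hypertrees (R - D) (L - C) (E\<inverse>)"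
        using fin by (intro less.hyps) auto
      ultimately have "hypertrees C D E \<times> hypertrees (L - C) (R - D) E
          \<approx> hypertrees (R - D) (L - C) (E\<inverse>) \<times> hypertrees D C (E\<inverse>)"
        by (blast intro: eqpoll_trans[OF times_eqpoll_cong times_commute_eqpoll])
      moreover have "R - (R - D) = D" "L - (L - C) = C" using p by auto
      ultimately show "hypertrees (fst p) (snd p) E \<times> hypertrees (L - fst p) (R - snd p) E
          \<approx> hypertrees (fst (?c p)) (snd (?c p)) (E\<inverse>)
            \<times> hypertrees (R - fst (?c p)) (L - snd (?c p)) (E\<inverse>)"
        using p(1) by simp
    qed
    also have "\<dots> \<approx> hypertrees R L (E\<inverse>)"
      using fin ij by (intro eqpoll_sym[OF hypertrees_eqpoll_edge_cuts]) auto
    finally show ?thesis .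
  qed
qed

section \<open>Lattice points of generalized permutohedra\<close>

text \<open>The conditions describe a convex set containing the vertices; conversely the coordinates
  of \<open>v\<close> are themselves the coefficients of a convex combination.\<close>

lemma coord_simplex_iff:
  fixes v :: "real ^ 'n::finite"
  shows "v \<in> coord_simplex I \<longleftrightarrow>
    (\<forall>j. v $ j \<ge> 0) \<and> (\<forall>j. j \<notin> I \<longrightarrow> v $ j = 0) \<and> (\<Sum>j\<in>UNIV. v $ j) = 1"
proof -
  let ?T = "{v :: real ^ 'n. (\<forall>j. v $ j \<ge> 0) \<and> (\<forall>j. j \<notin> I \<longrightarrow> v $ j = 0) \<and> (\<Sum>j\<in>UNIV. v $ j) = 1}"
  have "convex ?T"
    by (rule convexI) (auto simp: sum.distrib sum_distrib_left[symmetric])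
  moreover have "(\<lambda>i. axis i 1) ` I \<subseteq> ?T"
    by (auto simp: axis_def)
  ultimately have "coord_simplex I \<subseteq> ?T"
    unfolding coord_simplex_def by (simp add: hull_minimal)
  moreover have "v \<in> coord_simplex I" if "v \<in> ?T" for v
  proof -
    have "v = (\<Sum>j\<in>UNIV. v $ j *\<^sub>R axis j 1)"
      by (simp add: vec_eq_iff axis_def if_distrib cong: if_cong)
    also have "\<dots> = (\<Sum>j\<in>I. v $ j *\<^sub>R axis j 1)"
      using that by (intro sum.mono_neutral_right) auto
    finally have v: "v = (\<Sum>j\<in>I. v $ j *\<^sub>R axis j 1)" .
    have "(\<Sum>j\<in>I. v $ j) = (\<Sum>j\<in>UNIV. v $ j)"
      using that by (intro sum.mono_neutral_left) auto
    then have "(\<Sum>j\<in>I. v $ j *\<^sub>R axis j 1) \<in> coord_simplex I"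
      unfolding coord_simplex_def using that
      by (intro convex_sum) (auto intro: hull_inc)
    with v show ?thesis by simp
  qed
  ultimately show ?thesis by blast
qed

lemma gen_permutohedron_iff:
  "x \<in> gen_permutohedron m G y \<longleftrightarrow>
    (\<exists>v. (\<forall>i\<in>{1..m}. v i \<in> coord_simplex (assoc_set G i)) \<and> x = (\<Sum>i=1..m. y i *\<^sub>R v i))"
    (is "_ \<longleftrightarrow> ?R")
proof -
  have "x \<in> gen_permutohedron m G y \<longleftrightarrow>
      (\<exists>s. x = sum s {1..m} \<and> (\<forall>i\<in>{1..m}. s i \<in> (\<lambda>x. y i *\<^sub>R x) ` coord_simplex (assoc_set G i)))"
    unfolding gen_permutohedron_def set_sum_alt[OF finite_atLeastAtMost] by blast
  also have "\<dots> \<longleftrightarrow> ?R"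
  proof
    assume "\<exists>s. x = sum s {1..m} \<and>
      (\<forall>i\<in>{1..m}. s i \<in> (\<lambda>x. y i *\<^sub>R x) ` coord_simplex (assoc_set G i))"
    then obtain s where x: "x = sum s {1..m}"
      and "\<forall>i\<in>{1..m}. \<exists>v. v \<in> coord_simplex (assoc_set G i) \<and> s i = y i *\<^sub>R v"
      by blast
    from bchoice[OF this(2)]
    obtain v where v: "\<forall>i\<in>{1..m}. v i \<in> coord_simplex (assoc_set G i) \<and> s i = y i *\<^sub>R v i"
      by blast
    have "x = (\<Sum>i=1..m. y i *\<^sub>R v i)" unfolding x using v by (intro sum.cong) auto
    with v show ?R by blast
  qed blast
  finally show ?thesis .
qed

lemma convex_gen_permutohedron: "convex (gen_permutohedron m G y)"
  unfolding gen_permutohedron_def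
  by (intro convex_set_sum convex_scaling) (simp add: coord_simplex_def)

section \<open>Inequalities for the polytope and integral transport\<close>

text \<open>The submodular function that bounds coordinate sums over \<open>S\<close>; with
  \<open>y i\<close> copies of each left vertex it becomes the number of neighbours of
  \<open>S\<close>.\<close>

definition incident_weight :: "nat \<Rightarrow> (nat \<times> 'n::finite) set \<Rightarrow> (nat \<Rightarrow> nat) \<Rightarrow> 'n set \<Rightarrow> nat" where
  "incident_weight m G y S = (\<Sum>i=1..m. if assoc_set G i \<inter> S = {} then 0 else y i)"

lemma incident_weight_UNIV:
  assumes "\<And>i. i \<in> {1..m} \<Longrightarrow> assoc_set G i \<noteq> {}"
  shows "incident_weight m G y UNIV = (\<Sum>i=1..m. y i)"
  using assms unfolding incident_weight_def by (intro sum.cong) auto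

lemma incident_weight_submodular:
  "incident_weight m G y (S \<union> T) + incident_weight m G y (S \<inter> T)
    \<le> incident_weight m G y S + incident_weight m G y T"
  unfolding incident_weight_def sum.distrib[symmetric] by (intro sum_mono) auto

lemma incident_weight_dec:
  assumes "i \<in> {1..m}" "y i > 0"
  shows "incident_weight m G y S =
    incident_weight m G (y(i := y i - 1)) S + of_bool (assoc_set G i \<inter> S \<noteq> {})"
proof -
  have "incident_weight m G y S = (\<Sum>k=1..m. (if assoc_set G k \<inter> S = {} then 0 else (y(i := y i - 1)) k)
      + (if k = i then of_bool (assoc_set G i \<inter> S \<noteq> {}) else 0))"
    unfolding incident_weight_def using assms by (intro sum.cong) auto
  then show ?thesis using assms
    unfolding incident_weight_def[of m G "y(i := y i - 1)"] by (simp only: sum.distrib) simp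
qed

text \<open>A point of the \<open>i\<close>-th simplex has at most unit mass on \<open>S\<close>,
  and none if \<open>assoc_set G i\<close> misses \<open>S\<close>; scaling by \<open>y i\<close>
  and summing gives the bounds.\<close>

lemma sum_gen_permutohedron_le:
  assumes "x \<in> gen_permutohedron m G (\<lambda>i. real (y i))"
  shows "(\<Sum>j\<in>S. x $ j) \<le> real (incident_weight m G y S)"
    and "(\<Sum>j\<in>UNIV. x $ j) = real (\<Sum>i=1..m. y i)"
proof -
  obtain v where v: "\<And>i. i \<in> {1..m} \<Longrightarrow> v i \<in> coord_simplex (assoc_set G i)"
    and x: "x = (\<Sum>i=1..m. real (y i) *\<^sub>R v i)"
    using assms unfolding gen_permutohedron_iff by metis
  have sum: "(\<Sum>j\<in>S. x $ j) = (\<Sum>i=1..m. real (y i) * (\<Sum>j\<in>S. v i $ j))" for S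
    by (simp add: x sum_distrib_left sum.swap[of _ S])
  show "(\<Sum>j\<in>UNIV. x $ j) = real (\<Sum>i=1..m. y i)"
    using v unfolding sum by (simp add: coord_simplex_iff)
  have "(\<Sum>j\<in>S. v i $ j) \<le> of_bool (assoc_set G i \<inter> S \<noteq> {})" if "i \<in> {1..m}" for i
  proof (cases "assoc_set G i \<inter> S = {}")
    case True
    then have "j \<notin> assoc_set G i" if "j \<in> S" for j using that by auto
    then show ?thesis using True v[OF that] by (simp add: coord_simplex_iff)
  next
    case False
    have "(\<Sum>j\<in>S. v i $ j) \<le> (\<Sum>j\<in>UNIV. v i $ j)"
      using v[OF that] by (intro sum_mono2) (auto simp: coord_simplex_iff)
    then show ?thesis using False v[OF that] by (simp add: coord_simplex_iff)
  qed
  then have "(\<Sum>j\<in>S. x $ j) \<le> (\<Sum>i=1..m. real (y i) * of_bool (assoc_set G i \<inter> S \<noteq> {}))"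
    unfolding sum by (intro sum_mono mult_left_mono) auto
  also have "\<dots> = real (incident_weight m G y S)"
    unfolding incident_weight_def of_nat_sum by (intro sum.cong) auto
  finally show "(\<Sum>j\<in>S. x $ j) \<le> real (incident_weight m G y S)" .
qed

text \<open>
  One unit is sent from \<open>i\<close> at a time, to a vertex \<open>j\<close> of \<open>assoc_set G i\<close> lying in all tight sets
  that meet \<open>assoc_set G i\<close>; it exists because these sets are closed under intersection.
\<close>

lemma ex_transport:
  fixes z :: "'n::finite \<Rightarrow> int"
  assumes "\<And>i. i \<in> {1..m} \<Longrightarrow> assoc_set G i \<noteq> {}"
    and "\<And>S. sum z S \<le> int (incident_weight m G y S)"
    and "sum z UNIV = int (\<Sum>i=1..m. y i)"
  shows "\<exists>k :: nat \<Rightarrow> 'n \<Rightarrow> nat.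
    (\<forall>i\<in>{1..m}. (\<forall>j. j \<notin> assoc_set G i \<longrightarrow> k i j = 0) \<and> (\<Sum>j\<in>UNIV. k i j) = y i) \<and>
    (\<forall>j. z j = int (\<Sum>i=1..m. k i j))"
  using assms(2,3)
proof (induction "\<Sum>i=1..m. y i" arbitrary: y z)
  case 0
  then have y: "y i = 0" if "i \<in> {1..m}" for i using that by simp
  then have "incident_weight m G y S = 0" for S by (simp add: incident_weight_def)
  then have le: "sum z S \<le> 0" for S using "0.prems"(1)[of S] by simp
  have "z j = 0" for j
    using le[of "{j}"] le[of "UNIV - {j}"] "0.prems"(2) "0.hyps" sum.remove[of UNIV j z] by simp
  with y show ?case by (intro exI[of _ "\<lambda>_ _. 0"]) auto
next
  case (Suc n)
  have "\<exists>i\<in>{1..m}. y i > 0"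
  proof (rule ccontr)
    assume "\<not> ?thesis"
    then have "(\<Sum>i=1..m. y i) = 0" by auto
    with Suc.hyps(2) show False by simp
  qed
  then obtain i where i: "i \<in> {1..m}" "y i > 0" by blast
  let ?y = "y(i := y i - 1)"
  note dec = incident_weight_dec[of i m y G, OF i]
  let ?F = "{S. sum z S = int (incident_weight m G y S) \<and> assoc_set G i \<inter> S \<noteq> {}}"
  have "S \<inter> T \<in> ?F" if "S \<in> ?F" "T \<in> ?F" for S T
  proof -
    have un: "sum z (S \<union> T) + sum z (S \<inter> T) = sum z S + sum z T"
      by (rule sum.union_inter) auto
    have ne: "assoc_set G i \<inter> S \<noteq> {}" "assoc_set G i \<inter> T \<noteq> {}" "assoc_set G i \<inter> (S \<union> T) \<noteq> {}"
      using that by auto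
    \<comment> \<open>Otherwise lowering \<open>y i\<close> by one costs one in \<open>S\<close>,
      \<open>T\<close> and \<open>S \<union> T\<close> but nothing in \<open>S \<inter> T\<close>;
      submodularity for the lowered weights then leaves a gap of one, which two tight sets
      exclude.\<close>
    have "assoc_set G i \<inter> (S \<inter> T) \<noteq> {}"
    proof
      assume "assoc_set G i \<inter> (S \<inter> T) = {}"
      then show False
        using that un ne dec[of S] dec[of T] dec[of "S \<union> T"] dec[of "S \<inter> T"]
          incident_weight_submodular[of m G ?y S T] Suc.prems(1)[of "S \<union> T"] Suc.prems(1)[of "S \<inter> T"]
        by simp
    qed
    then show ?thesis
      using that un incident_weight_submodular[of m G y S T]
        Suc.prems(1)[of "S \<union> T"] Suc.prems(1)[of "S \<inter> T"] by auto
  qed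
  moreover have "UNIV \<in> ?F"
    using Suc.prems(2) assms(1) i incident_weight_UNIV[OF assms(1), of m] by simp
  ultimately have "\<Inter>?F \<in> ?F"
    by (intro finite_Inf_in) auto
  then obtain j where j: "j \<in> assoc_set G i" and j_tight: "\<And>S. S \<in> ?F \<Longrightarrow> j \<in> S" by blast
  let ?z = "z(j := z j - 1)"
  have z: "sum ?z S = sum z S - of_bool (j \<in> S)" for S
  proof -
    have "sum ?z S = (\<Sum>k\<in>S. z k - (if k = j then 1 else 0))" by (intro sum.cong) auto
    then show ?thesis by (simp add: sum_subtractf sum.delta)
  qed
  have y: "(\<Sum>i=1..m. y i) = (\<Sum>i=1..m. ?y i) + 1"
  proof -
    have "(\<Sum>i=1..m. y i) = (\<Sum>k=1..m. ?y k + (if k = i then 1 else 0))"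
      using i by (intro sum.cong) auto
    then show ?thesis using i by (simp only: sum.distrib) (simp add: sum.delta)
  qed
  have "\<exists>k :: nat \<Rightarrow> 'n \<Rightarrow> nat.
    (\<forall>i\<in>{1..m}. (\<forall>j. j \<notin> assoc_set G i \<longrightarrow> k i j = 0) \<and> (\<Sum>j\<in>UNIV. k i j) = ?y i) \<and>
    (\<forall>j. ?z j = int (\<Sum>i=1..m. k i j))"
  proof (rule Suc.hyps(1))
    show "n = sum ?y {1..m}" using Suc.hyps(2) y by simp
    show "sum ?z UNIV = int (sum ?y {1..m})" using Suc.prems(2) y z[of UNIV]
      by (simp del: fun_upd_apply of_nat_sum)
    \<comment> \<open>Either both sides drop by the same amount, or \<open>S\<close> meets
      \<open>assoc_set G i\<close> without containing \<open>j\<close>; it is then not tight, and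
      its slack covers the lowered weight.\<close>
    show "sum ?z S \<le> int (incident_weight m G ?y S)" for S
    proof (cases "assoc_set G i \<inter> S = {} \<or> j \<in> S")
      case True
      then have "of_bool (assoc_set G i \<inter> S \<noteq> {}) = (of_bool (j \<in> S) :: int)" using j by auto
      then show ?thesis using z[of S] dec[of S] Suc.prems(1)[of S]
        by (simp del: fun_upd_apply)
    next
      case False
      then have "S \<notin> ?F" using j_tight by blast
      then have "sum z S < int (incident_weight m G y S)"
        using False Suc.prems(1)[of S] by simp
      then show ?thesis using False z[of S] dec[of S] by (simp del: fun_upd_apply)
    qed
  qed
  then obtain k :: "nat \<Rightarrow> 'n \<Rightarrow> nat"
    where k: "\<And>i j. i \<in> {1..m} \<Longrightarrow> j \<notin> assoc_set G i \<Longrightarrow> k i j = 0"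
      "\<And>i. i \<in> {1..m} \<Longrightarrow> (\<Sum>j\<in>UNIV. k i j) = ?y i"
      and kz: "\<And>j. ?z j = int (\<Sum>i=1..m. k i j)" by blast
  define k' where "k' a b = k a b + (if a = i \<and> b = j then 1 else 0)" for a b
  have "(\<Sum>b\<in>UNIV. k' a b) = y a" if "a \<in> {1..m}" for a
    using k(2)[OF that] i by (cases "a = i") (simp_all add: k'_def sum.distrib)
  moreover have "z b = int (\<Sum>a=1..m. k' a b)" for b
  proof -
    have "(\<Sum>a=1..m. k' a b) = (\<Sum>a=1..m. k a b) + of_bool (b = j)"
      using i by (cases "b = j") (simp_all add: k'_def sum.distrib)
    then have "int (\<Sum>a=1..m. k' a b) = ?z b + of_bool (b = j)"
      using kz[of b] by (simp del: of_nat_sum fun_upd_apply)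
    then show ?thesis by simp
  qed
  moreover have "k' a b = 0" if "a \<in> {1..m}" "b \<notin> assoc_set G a" for a b
    using k(1)[OF that] that j by (auto simp: k'_def)
  ultimately show ?case by blast
qed

definition int_vec :: "('n \<Rightarrow> int) \<Rightarrow> real ^ 'n::finite" where
  "int_vec z = (\<chi> j. of_int (z j))"

lemma int_vec_nth [simp]: "int_vec z $ j = of_int (z j)"
  by (simp add: int_vec_def)

lemma bij_betw_int_vec: "bij_betw int_vec UNIV integer_lattice"
proof (rule bij_betw_byWitness[where f' = "\<lambda>x j. \<lfloor>x $ j\<rfloor>"])
  show "\<forall>x\<in>integer_lattice. int_vec (\<lambda>j. \<lfloor>x $ j\<rfloor>) = x"
    by (auto simp: integer_lattice_def vec_eq_iff elim: Ints_cases)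
qed (auto simp: integer_lattice_def)

text \<open>Necessity holds for all real points. For sufficiency the integral transport
  \<open>k\<close> is rescaled: row \<open>i\<close> divided by \<open>y i\<close> is a point of the
  \<open>i\<close>-th simplex.\<close>

lemma int_vec_in_gen_permutohedron_iff:
  fixes z :: "'n::finite \<Rightarrow> int"
  assumes ne: "\<And>i. i \<in> {1..m} \<Longrightarrow> assoc_set G i \<noteq> {}"
  shows "int_vec z \<in> gen_permutohedron m G (\<lambda>i. real (y i)) \<longleftrightarrow>
    (\<forall>S. sum z S \<le> int (incident_weight m G y S)) \<and> sum z UNIV = int (\<Sum>i=1..m. y i)"
proof
  assume P: "int_vec z \<in> gen_permutohedron m G (\<lambda>i. real (y i))"
  have "sum z S \<le> int (incident_weight m G y S)" for S
  proof -
    have "real_of_int (sum z S) \<le> real_of_int (int (incident_weight m G y S))"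
      using sum_gen_permutohedron_le(1)[OF P, of S] by simp
    then show ?thesis by (simp only: of_int_le_iff)
  qed
  moreover have "sum z UNIV = int (\<Sum>i=1..m. y i)"
  proof -
    have "real_of_int (sum z UNIV) = real_of_int (int (\<Sum>i=1..m. y i))"
      using sum_gen_permutohedron_le(2)[OF P] by simp
    then show ?thesis by (simp only: of_int_eq_iff)
  qed
  ultimately show "(\<forall>S. sum z S \<le> int (incident_weight m G y S)) \<and> sum z UNIV = int (\<Sum>i=1..m. y i)"
    by blast
next
  assume "(\<forall>S. sum z S \<le> int (incident_weight m G y S)) \<and> sum z UNIV = int (\<Sum>i=1..m. y i)"
  then have "\<exists>k :: nat \<Rightarrow> 'n \<Rightarrow> nat.
    (\<forall>i\<in>{1..m}. (\<forall>j. j \<notin> assoc_set G i \<longrightarrow> k i j = 0) \<and> (\<Sum>j\<in>UNIV. k i j) = y i) \<and>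
    (\<forall>j. z j = int (\<Sum>i=1..m. k i j))"
    by (intro ex_transport ne) auto
  then obtain k :: "nat \<Rightarrow> 'n \<Rightarrow> nat"
    where k: "\<And>i j. i \<in> {1..m} \<Longrightarrow> j \<notin> assoc_set G i \<Longrightarrow> k i j = 0"
      "\<And>i. i \<in> {1..m} \<Longrightarrow> (\<Sum>j\<in>UNIV. k i j) = y i"
      and z: "\<And>j. z j = int (\<Sum>i=1..m. k i j)"
    by blast
  \<comment> \<open>For \<open>y i = 0\<close> the quotient would be the zero vector, outside the
    simplex; any vertex serves there, since it is multiplied by \<open>0\<close>.\<close>
  define p where "p i = (SOME j. j \<in> assoc_set G i)" for i
  have p: "p i \<in> assoc_set G i" if "i \<in> {1..m}" for i
    using ne[OF that] unfolding p_def by (simp add: some_in_eq)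
  define v :: "nat \<Rightarrow> real ^ 'n" where
    "v i = (if y i = 0 then axis (p i) 1 else (\<chi> j. real (k i j) / real (y i)))" for i
  have "v i \<in> coord_simplex (assoc_set G i)" if "i \<in> {1..m}" for i
  proof (cases "y i = 0")
    case True
    then show ?thesis using p[OF that] by (auto simp: v_def coord_simplex_def intro: hull_inc)
  next
    case False
    then show ?thesis
      using k(1)[OF that] k(2)[OF that]
      by (simp add: v_def coord_simplex_iff flip: sum_divide_distrib of_nat_sum)
  qed
  moreover have "int_vec z $ j = (\<Sum>i=1..m. real (y i) *\<^sub>R v i) $ j" for j
  proof -
    have "real (k i j) = real (y i) * v i $ j" if "i \<in> {1..m}" for i
      using k(2)[OF that] by (cases "y i = 0") (simp_all add: v_def)
    then show ?thesis by (simp add: z)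
  qed
  ultimately show "int_vec z \<in> gen_permutohedron m G (\<lambda>i. real (y i))"
    unfolding gen_permutohedron_iff vec_eq_iff by blast
qed

text \<open>By convexity a translate of the full simplex lies in the polytope once its vertices do.
  A vertex direction \<open>j\<close> in \<open>S\<close> turns the weak inequality strict, and the
  added unit lowers the total by one.\<close>

lemma int_vec_in_trimmed_iff:
  fixes z :: "'n::finite \<Rightarrow> int"
  assumes ne: "\<And>i. i \<in> {1..m} \<Longrightarrow> assoc_set G i \<noteq> {}"
  shows "int_vec z \<in> trimmed_gen_permutohedron m G (\<lambda>i. real (y i)) \<longleftrightarrow>
    (\<forall>S. S \<noteq> {} \<longrightarrow> sum z S < int (incident_weight m G y S)) \<and>
    sum z UNIV = int (\<Sum>i=1..m. y i) - 1"
proof -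
  let ?P = "gen_permutohedron m G (\<lambda>i. real (y i))"
  let ?e = "\<lambda>j k. z k + of_bool (k = j)"
  have e: "int_vec z + axis j 1 = int_vec (?e j)" for j
    by (auto simp: vec_eq_iff axis_def)
  have sum_e: "sum (?e j) S = sum z S + of_bool (j \<in> S)" for j S
    by (simp add: sum.distrib of_bool_def sum.delta)
  have P: "int_vec (?e j) \<in> ?P \<longleftrightarrow>
      (\<forall>S. sum z S + of_bool (j \<in> S) \<le> int (incident_weight m G y S)) \<and>
      sum z UNIV + 1 = int (\<Sum>i=1..m. y i)" for j
    using int_vec_in_gen_permutohedron_iff[where z = "?e j" and y = y and G = G and m = m, OF ne] by (simp only: sum_e) simp
  have "int_vec z \<in> trimmed_gen_permutohedron m G (\<lambda>i. real (y i)) \<longleftrightarrow>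
      (\<lambda>v. int_vec z + v) ` coord_simplex UNIV \<subseteq> ?P"
    by (simp add: trimmed_gen_permutohedron_def)
  also have "(\<lambda>v. int_vec z + v) ` coord_simplex UNIV
      = convex hull ((\<lambda>v. int_vec z + v) ` range (\<lambda>i. axis i 1))"
    by (simp add: coord_simplex_def convex_hull_translation)
  also have "\<dots> \<subseteq> ?P \<longleftrightarrow> (\<lambda>v. int_vec z + v) ` range (\<lambda>i. axis i 1) \<subseteq> ?P"
    by (simp add: subset_hull convex_gen_permutohedron)
  also have "\<dots> \<longleftrightarrow> (\<forall>j. int_vec (?e j) \<in> ?P)"
    by (auto simp: e image_subset_iff)
  also have "\<dots> \<longleftrightarrow> (\<forall>j S. sum z S + of_bool (j \<in> S) \<le> int (incident_weight m G y S)) \<and>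
      sum z UNIV + 1 = int (\<Sum>i=1..m. y i)"
    by (simp only: P all_conj_distrib simp_thms)
  also have "(\<forall>j S. sum z S + of_bool (j \<in> S) \<le> int (incident_weight m G y S)) \<longleftrightarrow>
      (\<forall>S. S \<noteq> {} \<longrightarrow> sum z S < int (incident_weight m G y S))"
  proof (intro iffI allI impI)
    fix S :: "'n set"
    assume *: "\<forall>j S. sum z S + of_bool (j \<in> S) \<le> int (incident_weight m G y S)" and "S \<noteq> {}"
    then obtain j where "j \<in> S" by blast
    then show "sum z S < int (incident_weight m G y S)" using *[rule_format, of S j] by simp
  next
    fix S :: "'n set" and j
    assume *: "\<forall>S. S \<noteq> {} \<longrightarrow> sum z S < int (incident_weight m G y S)"
    show "sum z S + of_bool (j \<in> S) \<le> int (incident_weight m G y S)"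
      using *[rule_format, of S] by (cases "S = {}"; cases "j \<in> S") auto
  qed
  also have "sum z UNIV + 1 = int (\<Sum>i=1..m. y i) \<longleftrightarrow> sum z UNIV = int (\<Sum>i=1..m. y i) - 1"
    by linarith
  finally show ?thesis .
qed

section \<open>Counting by draconian sequences\<close>

definition copies :: "nat \<Rightarrow> (nat \<Rightarrow> nat) \<Rightarrow> (nat \<times> nat) set" where
  "copies m y = (SIGMA i:{1..m}. {..<y i})"

definition copy_edges :: "(nat \<times> 'n) set \<Rightarrow> ((nat \<times> nat) \<times> 'n) set" where
  "copy_edges G = {((i, k), j). (i, j) \<in> G}"

lemma finite_copies [simp]: "finite (copies m y)"
  by (simp add: copies_def)

lemma card_copies: "card (copies m y) = (\<Sum>i=1..m. y i)"
  by (simp add: copies_def)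

lemma card_copy_neighbours:
  "card ((copy_edges G)\<inverse> `` S \<inter> copies m y) = incident_weight m G y S"
proof -
  have "(copy_edges G)\<inverse> `` S \<inter> copies m y
      = (SIGMA i:{i \<in> {1..m}. assoc_set G i \<inter> S \<noteq> {}}. {..<y i})"
    by (auto simp: copy_edges_def copies_def assoc_set_def)
  also have "card \<dots> = (\<Sum>i | i \<in> {1..m} \<and> assoc_set G i \<inter> S \<noteq> {}. y i)"
    by simp
  also have "\<dots> = incident_weight m G y S"
    unfolding incident_weight_def sum.inter_filter[OF finite_atLeastAtMost]
    by (intro sum.cong) auto
  finally show ?thesis .
qed

text \<open>Neighbourhoods among the copies have size \<open>incident_weight\<close>, so the
  inequalities for the trimmed polytope are literally those of hypertrees; \<open>int_vec\<close> is
  the bijection.\<close>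

lemma trimmed_lattice_eqpoll_hypertrees:
  fixes G :: "(nat \<times> 'n::finite) set"
  assumes ne: "\<And>i. i \<in> {1..m} \<Longrightarrow> assoc_set G i \<noteq> {}"
  shows "hypertrees (copies m y) UNIV (copy_edges G)
    \<approx> trimmed_gen_permutohedron m G (\<lambda>i. real (y i)) \<inter> integer_lattice"
proof -
  let ?H = "hypertrees (copies m y) UNIV (copy_edges G)"
  let ?T = "trimmed_gen_permutohedron m G (\<lambda>i. real (y i))"
  have iff: "z \<in> ?H \<longleftrightarrow> int_vec z \<in> ?T" for z
    using int_vec_in_trimmed_iff[where z = z and y = y and G = G and m = m, OF ne]
    by (simp add: hypertrees_def card_copy_neighbours card_copies)
  have "int_vec ` ?H = ?T \<inter> integer_lattice"
  proof
    show "int_vec ` ?H \<subseteq> ?T \<inter> integer_lattice"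
      using iff bij_betw_apply[OF bij_betw_int_vec] by blast
    show "?T \<inter> integer_lattice \<subseteq> int_vec ` ?H"
    proof
      fix x :: "real ^ 'n" assume x: "x \<in> ?T \<inter> integer_lattice"
      then obtain z where "x = int_vec z"
        using bij_betw_imp_surj_on[OF bij_betw_int_vec] by blast
      with x iff show "x \<in> int_vec ` ?H" by blast
    qed
  qed
  moreover have "inj_on int_vec ?H"
    using bij_betw_imp_inj_on[OF bij_betw_int_vec] by (rule inj_on_subset) simp
  ultimately show ?thesis
    unfolding eqpoll_def bij_betw_def by blast
qed

section \<open>Hypertrees on the copies and draconian sequences\<close>

text \<open>The vertices other than \<open>j\<close> carry at most \<open>|L| - 1\<close>, which is
  the whole total. For \<open>R = {j}\<close> the entry is \<open>|L| - 1\<close> itself, whence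
  \<open>L \<noteq> {}\<close>.\<close>

lemma hypertree_nonneg:
  assumes fin: "finite L" "finite R" and x: "x \<in> hypertrees L R E"
    and "L \<noteq> {}" "j \<in> R"
  shows "x j \<ge> 0"
proof (cases "R - {j} = {}")
  case True
  then have "R = {j}" using \<open>j \<in> R\<close> by auto
  moreover have "card L > 0" using fin \<open>L \<noteq> {}\<close> by (simp add: card_gt_0_iff)
  ultimately show ?thesis using hypertreesD(3)[OF x] by simp
next
  case False
  have "sum x (R - {j}) < int (card (E\<inverse> `` (R - {j}) \<inter> L))"
    using hypertreesD(2)[OF x _ False] by blast
  also have "\<dots> \<le> int (card L)"
    using fin by (simp add: card_mono)
  finally have "sum x (R - {j}) \<le> sum x R" using hypertreesD(3)[OF x] by simp
  then show ?thesis using fin \<open>j \<in> R\<close> by (simp add: sum.remove)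
qed

text \<open>Copies of one left vertex have the same neighbours and \<open>b\<close> is nonnegative,
  so the inequalities for full fibres imply all others; on full fibres the sums of \<open>b\<close>
  are those of \<open>a\<close>.\<close>

lemma copies_hypertree_iff_draconian:
  fixes G :: "(nat \<times> 'n::finite) set"
  assumes ne: "\<And>i. i \<in> {1..m} \<Longrightarrow> assoc_set G i \<noteq> {}"
    and b: "b \<in> copies m y \<rightarrow>\<^sub>E UNIV" "\<And>p. p \<in> copies m y \<Longrightarrow> b p \<ge> 0"
    and a: "a \<in> {1..m} \<rightarrow>\<^sub>E UNIV"
      "\<And>i. i \<in> {1..m} \<Longrightarrow> int (a i) = (\<Sum>k<y i. b (i, k))"
  shows "b \<in> hypertrees UNIV (copies m y) ((copy_edges G)\<inverse>) \<longleftrightarrow> a \<in> draconian_seqs m G"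
proof -
  have sum_b: "sum b (SIGMA i:J. {..<y i}) = int (sum a J)" if "J \<subseteq> {1..m}" for J
  proof -
    have "finite J" using that finite_subset by blast
    then have "sum b (SIGMA i:J. {..<y i}) = (\<Sum>i\<in>J. \<Sum>k<y i. b (i, k))"
      by (simp add: sum.Sigma)
    also have "\<dots> = (\<Sum>i\<in>J. int (a i))" using a(2) that by (intro sum.cong) auto
    finally show ?thesis by simp
  qed
  have nbr: "((copy_edges G)\<inverse>)\<inverse> `` J \<inter> UNIV = (\<Union>i\<in>fst ` J. assoc_set G i)" for J
    by (auto simp: copy_edges_def assoc_set_def)
  show ?thesis
  proof
    assume h: "b \<in> hypertrees UNIV (copies m y) ((copy_edges G)\<inverse>)"
    have "int (sum a {1..m}) = int CARD('n) - 1"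
      using hypertreesD(3)[OF h] sum_b[of "{1..m}"] by (simp add: copies_def)
    then have "sum a {1..m} = CARD('n) - 1" by linarith
    moreover have "sum a J + 1 \<le> card (\<Union>i\<in>J. assoc_set G i)" if J: "J \<subseteq> {1..m}" "J \<noteq> {}" for J
    proof (cases "(SIGMA i:J. {..<y i}) = {}")
      \<comment> \<open>If \<open>y i = 0\<close> throughout \<open>J\<close>, there are no copies
        to which the hypertree inequality applies; the sum is then \<open>0\<close>, and a nonempty
        union suffices.\<close>
      case True
      then have "int (sum a J) = 0" using sum_b[OF J(1)] by (simp only: sum.empty)
      moreover have "card (\<Union>i\<in>J. assoc_set G i) > 0"
      proof -
        obtain i where i: "i \<in> J" using J by blast
        then have "assoc_set G i \<noteq> {}" using J by (intro ne) auto
        with i show ?thesis by (subst card_gt_0_iff) auto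
      qed
      ultimately show ?thesis by linarith
    next
      case False
      have "(SIGMA i:J. {..<y i}) \<subseteq> copies m y" using J by (auto simp: copies_def)
      from hypertreesD(2)[OF h this False]
      have "int (sum a J) < int (card (\<Union>i\<in>fst ` (SIGMA i:J. {..<y i}). assoc_set G i))"
        unfolding nbr sum_b[OF J(1)] .
      also have "\<dots> \<le> int (card (\<Union>i\<in>J. assoc_set G i))"
        by (intro of_nat_mono card_mono) auto
      finally show ?thesis by linarith
    qed
    ultimately show "a \<in> draconian_seqs m G" using a(1) by (simp add: draconian_seqs_def)
  next
    assume d: "a \<in> draconian_seqs m G"
    show "b \<in> hypertrees UNIV (copies m y) ((copy_edges G)\<inverse>)"
    proof (rule hypertreesI)
      have "sum a {1..m} = CARD('n) - 1" using d by (simp add: draconian_seqs_def)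
      \<comment> \<open>A nonempty right side makes the natural subtraction
        \<open>CARD('n) - 1\<close> exact.\<close>
      moreover have "CARD('n) > 0" by simp
      ultimately have "int (sum a {1..m}) = int CARD('n) - 1" by linarith
      then show "sum b (copies m y) = int CARD('n) - 1"
        using sum_b[of "{1..m}"] by (simp add: copies_def)
      fix J assume J: "J \<subseteq> copies m y" "J \<noteq> {}"
      have J1: "fst ` J \<subseteq> {1..m}" "fst ` J \<noteq> {}" using J by (auto simp: copies_def)
      have sub: "J \<subseteq> (SIGMA i:fst ` J. {..<y i})" "(SIGMA i:fst ` J. {..<y i}) \<subseteq> copies m y"
        using J by (force simp: copies_def)+
      \<comment> \<open>Filling up the fibres adds only nonnegative entries and no new
        neighbours.\<close>
      have "sum b J \<le> sum b (SIGMA i:fst ` J. {..<y i})"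
        using sub b(2) by (intro sum_mono2) (auto intro: finite_subset[OF _ finite_copies])
      also have "\<dots> = int (sum a (fst ` J))" by (rule sum_b[OF J1(1)])
      also have "\<dots> < int (card (\<Union>i\<in>fst ` J. assoc_set G i))"
      proof -
        have "sum a (fst ` J) + 1 \<le> card (\<Union>i\<in>fst ` J. assoc_set G i)"
          using d J1 unfolding draconian_seqs_def by blast
        then show ?thesis by linarith
      qed
      finally show "sum b J < int (card (((copy_edges G)\<inverse>)\<inverse> `` J \<inter> UNIV))"
        unfolding nbr .
    qed (use b in auto)
  qed
qed

lemma finite_length_sum_list: "finite {l :: nat list. length l = m \<and> sum_list l = N}"
proof (rule finite_subset)
  show "{l :: nat list. length l = m \<and> sum_list l = N} \<subseteq> {l. set l \<subseteq> {..N} \<and> length l = m}"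
    by (auto intro: member_le_sum_list)
qed (simp add: finite_lists_length_eq)

text \<open>Hypertrees are sorted by their fibre sums \<open>a\<close>. Over each draconian
  \<open>a\<close>, the fibre of \<open>i\<close> is an arbitrary list of length \<open>y i\<close>
  and sum \<open>a i\<close>, counted by stars and bars. For \<open>y i = 0\<close> the truncated
  binomial is correctly \<open>1\<close> if \<open>a i = 0\<close> and \<open>0\<close>
  otherwise.\<close>

lemma card_hypertrees_copies:
  fixes G :: "(nat \<times> 'n::finite) set"
  assumes ne: "\<And>i. i \<in> {1..m} \<Longrightarrow> assoc_set G i \<noteq> {}"
  shows "finite (hypertrees UNIV (copies m y) ((copy_edges G)\<inverse>))" (is "finite ?H")
    and "card (hypertrees UNIV (copies m y) ((copy_edges G)\<inverse>)) =
      (\<Sum>a\<in>draconian_seqs m G. \<Prod>i=1..m. (a i + y i - 1) choose a i)"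
proof -
  define F where "F a = (\<Pi>\<^sub>E i\<in>{1..m}. {l :: nat list. length l = y i \<and> sum_list l = a i})" for a
  define X where "X = (\<Union>a\<in>draconian_seqs m G. F a)"
  define \<psi> where "\<psi> l = (\<lambda>p\<in>copies m y. int (l (fst p) ! snd p))" for l :: "nat \<Rightarrow> nat list"
  have sum_psi: "int (sum_list (l i)) = (\<Sum>k<y i. \<psi> l (i, k))"
    if "i \<in> {1..m}" "length (l i) = y i" for l i
    using that by (simp add: \<psi>_def copies_def sum_list_sum_nth atLeast0LessThan)
  have finF: "finite (F a)" for a
    unfolding F_def by (intro finite_PiE finite_length_sum_list) simp
  have "inj_on \<psi> X"
  proof (rule inj_onI)
    fix l l' assume l: "l \<in> X" and l': "l' \<in> X" and eq: "\<psi> l = \<psi> l'"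
    have "l i = l' i" if i: "i \<in> {1..m}" for i
    proof (rule nth_equalityI)
      have "length (l i) = y i" "length (l' i) = y i"
        using l l' i by (auto simp: X_def F_def PiE_iff)
      then show "length (l i) = length (l' i)" by simp
      show "l i ! k = l' i ! k" if "k < length (l i)" for k
        using fun_cong[OF eq, of "(i, k)"] that i \<open>length (l i) = y i\<close>
        by (simp add: \<psi>_def copies_def)
    qed
    moreover have "l i = l' i" if "i \<notin> {1..m}" for i
      using l l' that by (auto simp: X_def F_def PiE_iff extensional_def)
    ultimately show "l = l'" by blast
  qed
  moreover have "\<psi> ` X = ?H"
  proof
    show "\<psi> ` X \<subseteq> ?H"
    proof
      fix b assume "b \<in> \<psi> ` X"
      then obtain l a where a: "a \<in> draconian_seqs m G" and l: "l \<in> F a" and b: "b = \<psi> l"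
        by (auto simp: X_def)
      have "int (a i) = (\<Sum>k<y i. b (i, k))" if "i \<in> {1..m}" for i
        using sum_psi[of i l] l that by (auto simp: b F_def PiE_iff)
      moreover have "a \<in> {1..m} \<rightarrow>\<^sub>E UNIV" using a by (simp add: draconian_seqs_def)
      ultimately show "b \<in> ?H"
        using copies_hypertree_iff_draconian[where b = b and y = y and a = a, OF ne] a
        by (auto simp: b \<psi>_def)
    qed
    show "?H \<subseteq> \<psi> ` X"
    proof
      fix b assume h: "b \<in> ?H"
      have nonneg: "b p \<ge> 0" if "p \<in> copies m y" for p
        using hypertree_nonneg[OF _ _ h _ that] by simp
      define l where "l = (\<lambda>i\<in>{1..m}. map (\<lambda>k. nat (b (i, k))) [0..<y i])"
      define a where "a = (\<lambda>i\<in>{1..m}. sum_list (l i))"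
      have b: "b = \<psi> l"
        using hypertreesD(1)[OF h] nonneg
        by (auto simp: \<psi>_def l_def copies_def PiE_iff extensional_def fun_eq_iff)
      have "int (a i) = (\<Sum>k<y i. \<psi> l (i, k))" if "i \<in> {1..m}" for i
        using sum_psi[of i l] that by (simp add: a_def l_def)
      then have "int (a i) = (\<Sum>k<y i. b (i, k))" if "i \<in> {1..m}" for i
        unfolding b using that by blast
      moreover have "a \<in> {1..m} \<rightarrow>\<^sub>E UNIV" by (simp add: a_def)
      ultimately have "a \<in> draconian_seqs m G"
        using copies_hypertree_iff_draconian[where b = b and y = y and a = a, OF ne]
          hypertreesD(1)[OF h] nonneg h by blast
      moreover have "l \<in> F a" by (auto simp: F_def l_def a_def)
      ultimately show "b \<in> \<psi> ` X" using b unfolding X_def by blast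
    qed
  qed
  ultimately have bij: "bij_betw \<psi> X ?H" by (simp add: bij_betw_def)
  have "finite X"
    unfolding X_def using finF finite_draconian_seqs by blast
  with bij show "finite ?H" by (simp add: bij_betw_finite)
  have disj: "F a \<inter> F a' = {}" if "a \<in> draconian_seqs m G" "a' \<in> draconian_seqs m G" "a \<noteq> a'" for a a'
  proof (rule ccontr)
    assume "F a \<inter> F a' \<noteq> {}"
    then obtain l where "l \<in> F a" "l \<in> F a'" by blast
    then have "a i = a' i" if "i \<in> {1..m}" for i
      using that by (auto simp: F_def PiE_iff)
    then have "a = a'"
      using that(1,2) by (intro PiE_ext[of a "{1..m}" "\<lambda>_. UNIV" a']) (auto simp: draconian_seqs_def)
    with that show False by simp
  qed
  have "card ?H = card X" using bij by (simp add: bij_betw_same_card)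
  also have "\<dots> = (\<Sum>a\<in>draconian_seqs m G. card (F a))"
    unfolding X_def using finF disj by (intro card_UN_disjoint finite_draconian_seqs) auto
  also have "\<dots> = (\<Sum>a\<in>draconian_seqs m G. \<Prod>i=1..m. (a i + y i - 1) choose a i)"
    by (simp add: F_def card_PiE card_length_sum_list)
  finally show "card ?H = (\<Sum>a\<in>draconian_seqs m G. \<Prod>i=1..m. (a i + y i - 1) choose a i)" .
qed

section \<open>Lattice-point counts\<close>

lemma pochhammer_over_fact_eq_binomial:
  "pochhammer (real y) a / fact a = real ((a + y - 1) choose a)"
proof (cases "y = 0")
  \<comment> \<open>Here the subtraction is truncated: both sides are \<open>1\<close> at
    \<open>a = 0\<close> and \<open>0\<close> beyond it.\<close>
  case True
  then show ?thesis by (cases a) (auto simp: pochhammer_0_left)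
next
  case False
  then have "real (a + y - 1) - real a + 1 = real y" by (simp add: of_nat_diff)
  then show ?thesis by (simp add: binomial_gbinomial gbinomial_pochhammer')
qed

lemma card_trimmed_lattice:
  fixes G :: "(nat \<times> 'n::finite) set"
  assumes ne: "\<And>i. i \<in> {1..m} \<Longrightarrow> assoc_set G i \<noteq> {}"
  shows "finite (trimmed_gen_permutohedron m G (\<lambda>i. real (y i)) \<inter> integer_lattice)" (is "finite ?T")
    and "real (card (trimmed_gen_permutohedron m G (\<lambda>i. real (y i)) \<inter> integer_lattice)) =
      (\<Sum>a\<in>draconian_seqs m G. \<Prod>i=1..m. pochhammer (real (y i)) (a i) / fact (a i))"
proof -
  have "hypertrees (copies m y) UNIV (copy_edges G) \<approx> ?T"
    by (rule trimmed_lattice_eqpoll_hypertrees[OF ne])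
  moreover have "hypertrees (copies m y) UNIV (copy_edges G)
      \<approx> hypertrees UNIV (copies m y) ((copy_edges G)\<inverse>)"
    by (rule hypertrees_converse_eqpoll) simp_all
  ultimately have "hypertrees UNIV (copies m y) ((copy_edges G)\<inverse>) \<approx> ?T"
    using eqpoll_sym eqpoll_trans by blast
  then obtain f where f: "bij_betw f (hypertrees UNIV (copies m y) ((copy_edges G)\<inverse>)) ?T"
    unfolding eqpoll_def by blast
  show "finite ?T"
    using bij_betw_finite[OF f] card_hypertrees_copies(1)[where G = G and m = m, OF ne] by blast
  show "real (card ?T) =
      (\<Sum>a\<in>draconian_seqs m G. \<Prod>i=1..m. pochhammer (real (y i)) (a i) / fact (a i))"
    using bij_betw_same_card[OF f] card_hypertrees_copies(2)[where G = G and m = m and y = y, OF ne]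
    by (simp add: pochhammer_over_fact_eq_binomial)
qed

text \<open>Raising the weight of a full vertex adds a summand that trimming takes away again: the
  bound of each nonempty \<open>S\<close> grows by one, so strict bounds become weak, and the totals
  match.\<close>

lemma gen_permutohedron_lattice_eq_trimmed:
  fixes G :: "(nat \<times> 'n::finite) set"
  assumes ne: "\<And>i. i \<in> {1..m} \<Longrightarrow> assoc_set G i \<noteq> {}"
    and i: "i \<in> {1..m}" "assoc_set G i = UNIV"
  shows "gen_permutohedron m G (\<lambda>k. real (y k)) \<inter> integer_lattice =
    trimmed_gen_permutohedron m G (\<lambda>k. real ((y(i := y i + 1)) k)) \<inter> integer_lattice"
proof -
  let ?y = "y(i := y i + 1)"
  have w: "incident_weight m G ?y S = incident_weight m G y S + of_bool (S \<noteq> {})" for S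
    using incident_weight_dec[of i m ?y G S] i by simp
  have total: "(\<Sum>k=1..m. ?y k) = (\<Sum>k=1..m. y k) + 1"
    using w[of UNIV] incident_weight_UNIV[OF ne] by simp
  have lt_iff: "c < int (incident_weight m G ?y S) \<longleftrightarrow> c \<le> int (incident_weight m G y S)"
    if "S \<noteq> {}" for c S
    using w[of S] that by auto
  have "int_vec z \<in> gen_permutohedron m G (\<lambda>k. real (y k)) \<longleftrightarrow>
      int_vec z \<in> trimmed_gen_permutohedron m G (\<lambda>k. real (?y k))" for z :: "'n \<Rightarrow> int"
  proof -
    have "int_vec z \<in> trimmed_gen_permutohedron m G (\<lambda>k. real (?y k)) \<longleftrightarrow>
      (\<forall>S. S \<noteq> {} \<longrightarrow> sum z S < int (incident_weight m G ?y S)) \<and>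
      sum z UNIV = int (\<Sum>k=1..m. ?y k) - 1"
      by (intro int_vec_in_trimmed_iff ne)
    also have "\<dots> \<longleftrightarrow> (\<forall>S. S \<noteq> {} \<longrightarrow> sum z S \<le> int (incident_weight m G y S)) \<and>
      sum z UNIV = int (\<Sum>k=1..m. y k)"
      using lt_iff total by auto
    \<comment> \<open>The empty set may be included, its sum \<open>0\<close> being below any
      natural number.\<close>
    also have "\<dots> \<longleftrightarrow> (\<forall>S. sum z S \<le> int (incident_weight m G y S)) \<and>
      sum z UNIV = int (\<Sum>k=1..m. y k)"
      by (metis sum.empty of_nat_0_le_iff)
    also have "\<dots> \<longleftrightarrow> int_vec z \<in> gen_permutohedron m G (\<lambda>k. real (y k))"
      by (intro int_vec_in_gen_permutohedron_iff[symmetric] ne)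
    finally show ?thesis by blast
  qed
  moreover have "\<exists>z. x = int_vec z" if "x \<in> integer_lattice" for x :: "real ^ 'n"
    using that bij_betw_imp_surj_on[OF bij_betw_int_vec] by blast
  ultimately show ?thesis by blast
qed

theorem theorem11p3:
  fixes m :: nat and G :: "(nat \<times> 'n::finite) set" and y :: "nat \<Rightarrow> nat"
  assumes "m \<ge> 1"
    and "bipartite_subgraph m G"
    and "no_isolated_vertices m G"
  shows
    "(finite (trimmed_gen_permutohedron m G (\<lambda>i. real (y i)) \<inter> integer_lattice) \<and>
      real (card (trimmed_gen_permutohedron m G (\<lambda>i. real (y i)) \<inter> integer_lattice)) =
        (\<Sum>a\<in>draconian_seqs m G. \<Prod>i=1..m. pochhammer (real (y i)) (a i) / fact (a i))) \<and>
     (assoc_set G 1 = UNIV \<longrightarrow>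
      finite (gen_permutohedron m G (\<lambda>i. real (y i)) \<inter> integer_lattice) \<and>
      real (card (gen_permutohedron m G (\<lambda>i. real (y i)) \<inter> integer_lattice)) =
        (\<Sum>a\<in>draconian_seqs m G. pochhammer (real (y 1) + 1) (a 1) / fact (a 1) *
           (\<Prod>i=2..m. pochhammer (real (y i)) (a i) / fact (a i)))) \<and>
     (finite (trimmed_gen_permutohedron m G (\<lambda>i. 1) \<inter> integer_lattice) \<and>
      card (trimmed_gen_permutohedron m G (\<lambda>i. 1) \<inter> integer_lattice) =
        card (draconian_seqs m G))"
proof -
  have ne: "assoc_set G i \<noteq> {}" if "i \<in> {1..m}" for i
    using assms(3) that by (auto simp: no_isolated_vertices_def assoc_set_def)
  let ?P = "gen_permutohedron m G (\<lambda>i. real (y i)) \<inter> integer_lattice"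
  have "finite ?P \<and> real (card ?P) =
      (\<Sum>a\<in>draconian_seqs m G. pochhammer (real (y 1) + 1) (a 1) / fact (a 1) *
         (\<Prod>i=2..m. pochhammer (real (y i)) (a i) / fact (a i)))" if "assoc_set G 1 = UNIV"
  proof -
    let ?y = "y(1 := y 1 + 1)"
    have one: "1 \<in> {1..m}" using assms(1) by simp
    have "?P = trimmed_gen_permutohedron m G (\<lambda>i. real (?y i)) \<inter> integer_lattice"
      by (rule gen_permutohedron_lattice_eq_trimmed[OF ne one that])
    then have "finite ?P" and card: "real (card ?P) =
        (\<Sum>a\<in>draconian_seqs m G. \<Prod>i=1..m. pochhammer (real (?y i)) (a i) / fact (a i))"
      using card_trimmed_lattice[where y = ?y and G = G and m = m, OF ne] by simp_all
    moreover have "(\<Prod>i=1..m. pochhammer (real (?y i)) (a i) / fact (a i)) =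
        pochhammer (real (y 1) + 1) (a 1) / fact (a 1) *
         (\<Prod>i=2..m. pochhammer (real (y i)) (a i) / fact (a i))" for a
    proof -
      have "{1..m} = insert 1 {2..m}" using assms(1) by auto
      then have "(\<Prod>i=1..m. pochhammer (real (?y i)) (a i) / fact (a i)) =
          pochhammer (real (?y 1)) (a 1) / fact (a 1) *
          (\<Prod>i=2..m. pochhammer (real (?y i)) (a i) / fact (a i))" by simp
      also have "(\<Prod>i=2..m. pochhammer (real (?y i)) (a i) / fact (a i)) =
          (\<Prod>i=2..m. pochhammer (real (y i)) (a i) / fact (a i))"
        by (intro prod.cong) auto
      finally show ?thesis by (simp add: add.commute)
    qed
    ultimately show ?thesis by simp
  qed
  \<comment> \<open>With unit weights each factor is
    \<open>pochhammer 1 (a i) / fact (a i) = 1\<close>, so the sum counts its index set.\<close>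
  moreover have "finite (trimmed_gen_permutohedron m G (\<lambda>i. 1) \<inter> integer_lattice) \<and>
      card (trimmed_gen_permutohedron m G (\<lambda>i. 1) \<inter> integer_lattice) = card (draconian_seqs m G)"
    using card_trimmed_lattice[where y = "\<lambda>_. 1" and G = G and m = m, OF ne]
    by (simp add: pochhammer_fact[symmetric])
  ultimately show ?thesis
    using card_trimmed_lattice[where y = y and G = G and m = m, OF ne] by blast
qed

end
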